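(* Let $p\ge1$, let $\varphi:\mathbb{R}^n\times\mathbb{R}^{n_1}\times\dots\times\mathbb{R}^{n_p}\to\mathbb{R}^n$ be Lipschitz continuous in each of its arguments with Lipschitz constants $L_i$ ($i=0,\dots,p$; $L_0$ for the first argument $\mathbf{x}$ and $L_i$ for the argument $\mathbf{u}_i$). Assume that the solution maps $(\mathbf{x},\mathbf{u}_1,\dots,\mathbf{u}_{i-1})\mapsto\mathbf{u}_i$ are Lipschitz continuous with respect to each of their arguments, with constants $K_{i,j}$ ($i=1,\dots,p$, $j=0,\dots,i-1$; $j=0$ for the argument $\mathbf{x}$ and $j\geq 1$ for the argument $\mathbf{u}_j$). Assume $$L_0+\sum_{j=1}^pL_j\sum_{\sigma\in d_{0,j}}\prod_{m=1}^{|\sigma|-1}K_{\sigma_m,\sigma_{m+1}}<1,$$ where $d_{i,j}$ is the set of strictly decreasing integer sequences starting at $j$ and ending at $i$. Then $G(\mathbf{x})=\varphi(\mathbf{x},\mathbf{u}_1,\dots,\mathbf{u}_p)$ is a contraction.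
   Context: For $i=1,\dots,p$, the vector $\mathbf{u}_i\in\mathbb{R}^{n_i}$ is the solution of a linear system whose data depend on $\mathbf{x}\in\mathbb{R}^n$ and on the previous solutions: $\mathbf{u}_i=A_i^{-1}F_i$, with $A_i=A_i(\mathbf{x},\mathbf{u}_1,\dots,\mathbf{u}_{i-1})\in\mathrm{GL}_{n_i}(\mathbb{R})$ and $F_i=F_i(\mathbf{x},\mathbf{u}_1,\dots,\mathbf{u}_{i-1})\in\mathbb{R}^{n_i}$. This defines the solution maps $(\mathbf{x},\mathbf{u}_1,\dots,\mathbf{u}_{i-1})\mapsto\mathbf{u}_i$. In $G(\mathbf{x})=\varphi(\mathbf{x},\mathbf{u}_1,\dots,\mathbf{u}_p)$ the $\mathbf{u}_i$ are computed recursively from $\mathbf{x}$: $\mathbf{u}_1=\mathbf{u}_1(\mathbf{x})$, $\mathbf{u}_2=\mathbf{u}_2(\mathbf{x},\mathbf{u}_1)$, etc., so $G:\mathbb{R}^n\to\mathbb{R}^n$. Each space carries a norm, denoted $\|\cdot\|$. "Lipschitz continuous in an argument with constant $c$" means $c$-Lipschitz in that argument when the others are held fixed, uniformly over the values of the others. A contraction is a map that is $L$-Lipschitz for some $L<1$. A sequence $\sigma\in d_{i,j}$ is written $\sigma=(\sigma_1,\dots,\sigma_{|\sigma|})$ with $\sigma_1=j$, $\sigma_{|\sigma|}=i$, $\sigma_m>\sigma_{m+1}$, and $|\sigma|$ is its number of terms. *)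

theory Defs
  imports Complex_Main "HOL-Library.FuncSet" "Jordan_Normal_Form.Matrix"
begin

(* The spaces R^n, R^(n_1), ..., R^(n_p) are carrier_vec (d 0), carrier_vec (d 1), ...,
   carrier_vec (d p): index 0 always belongs to x, index i to u_i. *)

definition is_norm :: "nat \<Rightarrow> (real vec \<Rightarrow> real) \<Rightarrow> bool" where
  "is_norm k \<nu> \<longleftrightarrow>
     (\<forall>v\<in>carrier_vec k. 0 \<le> \<nu> v \<and> (\<nu> v = 0 \<longleftrightarrow> v = 0\<^sub>v k)) \<and>
     (\<forall>v\<in>carrier_vec k. \<forall>a. \<nu> (a \<cdot>\<^sub>v v) = \<bar>a\<bar> * \<nu> v) \<and>
     (\<forall>v\<in>carrier_vec k. \<forall>w\<in>carrier_vec k. \<nu> (v + w) \<le> \<nu> v + \<nu> w)"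

(* The product of the first k spaces: (x, u_1, ..., u_(k-1)) is the extensional function w
   with w 0 = x and w j = u_j for 0 < j < k. So the data of the i-th system live on tuples d i,
   and \<phi> lives on tuples d (Suc p). *)

definition tuples :: "(nat \<Rightarrow> nat) \<Rightarrow> nat \<Rightarrow> (nat \<Rightarrow> real vec) set" where
  "tuples d k = (\<Pi>\<^sub>E i\<in>{..<k}. carrier_vec (d i))"

abbreviation GL :: "nat \<Rightarrow> real mat set" where
  "GL k \<equiv> Units (ring_mat TYPE(real) k ())"

abbreviation GL_inverse :: "nat \<Rightarrow> real mat \<Rightarrow> real mat" where
  "GL_inverse k \<equiv> m_inv (ring_mat TYPE(real) k ())"

definition solution_map ::
  "(nat \<Rightarrow> nat) \<Rightarrow> (nat \<Rightarrow> (nat \<Rightarrow> real vec) \<Rightarrow> real mat) \<Rightarrow> (nat \<Rightarrow> (nat \<Rightarrow> real vec) \<Rightarrow> real vec)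
     \<Rightarrow> nat \<Rightarrow> (nat \<Rightarrow> real vec) \<Rightarrow> real vec" where
  "solution_map d A F i w = GL_inverse (d i) (A i w) *\<^sub>v F i w"

(* all_args U k x is the tuple (x, u_1, ..., u_k) obtained by u_i = U i (x, u_1, ..., u_(i-1)). *)

primrec all_args ::
  "(nat \<Rightarrow> (nat \<Rightarrow> real vec) \<Rightarrow> real vec) \<Rightarrow> nat \<Rightarrow> real vec \<Rightarrow> (nat \<Rightarrow> real vec)" where
  "all_args U 0 x = (\<lambda>_. undefined)(0 := x)"
| "all_args U (Suc k) x = (all_args U k x)(Suc k := U (Suc k) (all_args U k x))"

(* f is c-Lipschitz in its j-th argument, uniformly in the other arguments; \<mu> is the norm of the
   target. As in lipschitz_on, a Lipschitz constant is nonnegative by definition. *)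

definition lipschitz_in_arg ::
  "(nat \<Rightarrow> nat) \<Rightarrow> (nat \<Rightarrow> real vec \<Rightarrow> real) \<Rightarrow> nat \<Rightarrow> nat \<Rightarrow> real
     \<Rightarrow> (real vec \<Rightarrow> real) \<Rightarrow> ((nat \<Rightarrow> real vec) \<Rightarrow> real vec) \<Rightarrow> bool" where
  "lipschitz_in_arg d \<nu> k j c \<mu> f \<longleftrightarrow>
     0 \<le> c \<and>
     (\<forall>w\<in>tuples d k. \<forall>y\<in>carrier_vec (d j). \<mu> (f (w(j := y)) - f w) \<le> c * \<nu> j (y - w j))"

definition is_contraction :: "nat \<Rightarrow> (real vec \<Rightarrow> real) \<Rightarrow> (real vec \<Rightarrow> real vec) \<Rightarrow> bool" where
  "is_contraction k \<nu> G \<longleftrightarrow>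
     G \<in> carrier_vec k \<rightarrow> carrier_vec k \<and>
     (\<exists>L. 0 \<le> L \<and> L < 1 \<and>
        (\<forall>x\<in>carrier_vec k. \<forall>y\<in>carrier_vec k. \<nu> (G x - G y) \<le> L * \<nu> (x - y)))"

(* Strictly decreasing sequences (\<sigma>_1, ..., \<sigma>_r) with \<sigma>_1 = j and \<sigma>_r = i; lists are indexed from 0,
   so \<sigma>_m is \<sigma> ! (m - 1). *)

definition dec_seqs :: "nat \<Rightarrow> nat \<Rightarrow> nat list set" where
  "dec_seqs i j = {\<sigma>. \<sigma> \<noteq> [] \<and> hd \<sigma> = j \<and> last \<sigma> = i \<and> sorted_wrt (>) \<sigma>}"

lemma finite_dec_seqs: "finite (dec_seqs i j)"
proof (rule finite_subset)
  show "dec_seqs i j \<subseteq> {\<sigma>. set \<sigma> \<subseteq> {..j} \<and> distinct \<sigma>}"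
  proof
    fix \<sigma> assume "\<sigma> \<in> dec_seqs i j"
    then have ne: "\<sigma> \<noteq> []" and hd: "hd \<sigma> = j" and s: "sorted_wrt (>) \<sigma>"
      by (auto simp: dec_seqs_def)
    have "set \<sigma> \<subseteq> {..j}" using ne hd s by (cases \<sigma>) auto
    moreover have "distinct \<sigma>" using s by (induction \<sigma>) auto
    ultimately show "\<sigma> \<in> {\<sigma>. set \<sigma> \<subseteq> {..j} \<and> distinct \<sigma>}" by simp
  qed
  show "finite {\<sigma>. set \<sigma> \<subseteq> {..j} \<and> distinct \<sigma>}"
    by (rule finite_subset_distinct) simp
qed

end

theory Submission
  imports Defs
begin

text \<open>
  Unrolling the recursion \<open>u\<^sub>i = u\<^sub>i(x, u\<^sub>1, \<dots>, u\<^sub>i\<^sub>-\<^sub>1)\<close> shows every way in which a perturbation of \<open>x\<close>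
  can reach \<open>u\<^sub>j\<close>: it passes through a chain of intermediate solutions with increasing indices, that
  is, along a sequence decreasing from \<open>j\<close> to \<open>0\<close> when read backwards, and each step of the chain
  costs one factor \<open>K\<close>. Hence \<open>x \<mapsto> u\<^sub>j\<close> should have as Lipschitz constant the total weight
  of these chains (\<open>chain_weight\<close>), and the hypothesis says exactly that feeding these constants
  into \<open>\<phi>\<close> gives a number below \<open>1\<close>.

  Two facts turn this picture into a proof. The first is analytic: a function which is Lipschitz in
  each argument separately satisfies the joint estimate \<open>\<mu> (f w - f w') \<le> \<Sum>\<^sub>j c\<^sub>j \<nu>\<^sub>j (w\<^sub>j - w'\<^sub>j)\<close>
  (\<open>joint_lipschitz_estimate\<close>), because the arguments can be exchanged one at a time. Applied to the
  solution maps, it bounds the variation of \<open>u\<^sub>i\<close> by the sum over \<open>j < i\<close> of \<open>K i j\<close> times the variation of \<open>u\<^sub>j\<close>. The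
  second is combinatorial: splitting off the last step of a chain shows that the weights solve the
  same recursion with equality (\<open>chain_weight_rec\<close>). Induction on \<open>i\<close> then matches the two
  (\<open>all_args_lipschitz\<close>), and one more joint estimate, for \<open>\<phi>\<close>, finishes the proof.
\<close>

section \<open>Joint estimates from Lipschitz continuity in each argument\<close>

lemma is_norm_diff_self: "is_norm k \<nu> \<Longrightarrow> v \<in> carrier_vec k \<Longrightarrow> \<nu> (v - v) = 0"
  by (simp add: is_norm_def)

lemma is_norm_diff_triangle:
  assumes "is_norm k \<nu>" and "u \<in> carrier_vec k" "v \<in> carrier_vec k" "w \<in> carrier_vec k"
  shows "\<nu> (u - w) \<le> \<nu> (u - v) + \<nu> (v - w)"
proof -
  have "u - w = (u - v) + (v - w)"
    using assms(2-4) by (intro eq_vecI) auto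
  moreover have "u - v \<in> carrier_vec k" "v - w \<in> carrier_vec k"
    using assms(2-4) by auto
  ultimately show ?thesis
    using assms(1) by (simp add: is_norm_def)
qed

lemma tuples_memD: "w \<in> tuples d k \<Longrightarrow> j < k \<Longrightarrow> w j \<in> carrier_vec (d j)"
  by (auto simp: tuples_def)

text \<open>
  The tuples that agree with \<open>w\<close> below \<open>l\<close> and with \<open>w'\<close> from \<open>l\<close> on lead from \<open>w'\<close> to \<open>w\<close> by
  changing a single argument at a time, so the separate Lipschitz bounds add up.
\<close>

lemma joint_lipschitz_estimate:
  assumes norm: "is_norm n \<mu>"
    and f: "f \<in> tuples d k \<rightarrow> carrier_vec n"
    and lip: "\<And>j. j < k \<Longrightarrow> lipschitz_in_arg d \<nu> k j (c j) \<mu> f"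
    and w: "w \<in> tuples d k" and w': "w' \<in> tuples d k"
  shows "\<mu> (f w - f w') \<le> (\<Sum>j<k. c j * \<nu> j (w j - w' j))"
proof -
  define z where "z l = (\<lambda>j. if j < l then w j else w' j)" for l
  have z_in: "z l \<in> tuples d k" for l
    using w w' by (auto simp: z_def tuples_def PiE_iff extensional_def)
  have z0: "z 0 = w'"
    by (simp add: z_def)
  have "\<mu> (f (z l) - f w') \<le> (\<Sum>j<l. c j * \<nu> j (w j - w' j))" if "l \<le> k" for l
    using that
  proof (induction l)
    case 0
    show ?case
      using is_norm_diff_self[OF norm funcset_mem[OF f w']] by (simp add: z0)
  next
    case (Suc l)
    have step: "z (Suc l) = (z l)(l := w l)"
      by (auto simp: z_def fun_eq_iff)
    have "\<mu> (f (z (Suc l)) - f w') \<le> \<mu> (f (z (Suc l)) - f (z l)) + \<mu> (f (z l) - f w')"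
      using f z_in w' by (intro is_norm_diff_triangle[OF norm]) auto
    also have "\<mu> (f (z (Suc l)) - f (z l)) \<le> c l * \<nu> l (w l - z l l)"
      using lip[of l] Suc.prems z_in[of l] tuples_memD[OF w, of l]
      unfolding step lipschitz_in_arg_def by auto
    also have "z l l = w' l"
      by (simp add: z_def)
    finally show ?case
      using Suc by simp
  qed
  moreover have "z k = w"
    using w w' by (auto simp: z_def tuples_def PiE_iff extensional_def fun_eq_iff)
  ultimately show ?thesis
    by (metis order_refl)
qed

section \<open>Total weight of the decreasing sequences\<close>

definition seq_weight :: "(nat \<Rightarrow> nat \<Rightarrow> real) \<Rightarrow> nat list \<Rightarrow> real" where
  "seq_weight K \<sigma> = (\<Prod>m=1..length \<sigma> - 1. K (\<sigma> ! (m - 1)) (\<sigma> ! m))"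

definition chain_weight :: "(nat \<Rightarrow> nat \<Rightarrow> real) \<Rightarrow> nat \<Rightarrow> nat \<Rightarrow> real" where
  "chain_weight K i j = (\<Sum>\<sigma>\<in>dec_seqs i j. seq_weight K \<sigma>)"

lemma seq_weight_Cons:
  assumes "\<sigma> \<noteq> []"
  shows "seq_weight K (j # \<sigma>) = K j (hd \<sigma>) * seq_weight K \<sigma>"
proof -
  obtain n where n: "length \<sigma> = Suc n"
    using assms by (cases \<sigma>) auto
  have "seq_weight K (j # \<sigma>) = (\<Prod>m=1..Suc n. K ((j # \<sigma>) ! (m - 1)) ((j # \<sigma>) ! m))"
    by (simp add: seq_weight_def n)
  also have "\<dots> = K j (\<sigma> ! 0) * (\<Prod>m=Suc 1..Suc n. K ((j # \<sigma>) ! (m - 1)) ((j # \<sigma>) ! m))"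
    by (subst prod.atLeast_Suc_atMost) simp_all
  also have "(\<Prod>m=Suc 1..Suc n. K ((j # \<sigma>) ! (m - 1)) ((j # \<sigma>) ! m))
      = (\<Prod>m=1..n. K ((j # \<sigma>) ! m) ((j # \<sigma>) ! Suc m))"
    by (subst prod.atLeast_Suc_atMost_Suc_shift) simp
  also have "\<dots> = seq_weight K \<sigma>"
    unfolding seq_weight_def n by (intro prod.cong) (auto simp: nth_Cons')
  finally show ?thesis
    using assms by (simp add: hd_conv_nth)
qed

lemma dec_seqs_refl: "dec_seqs i i = {[i]}"
proof -
  have "\<sigma> = [i]" if "\<sigma> \<in> dec_seqs i i" for \<sigma>
    using that last_in_set[of "tl \<sigma>"] by (cases \<sigma>) (fastforce simp: dec_seqs_def split: if_splits)+
  then show ?thesis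
    by (auto simp: dec_seqs_def)
qed

lemma dec_seqs_split_first:
  assumes "i < j"
  shows "dec_seqs i j = (\<Union>k\<in>{i..<j}. (#) j ` dec_seqs i k)"
proof (intro equalityI subsetI)
  fix \<sigma> assume "\<sigma> \<in> dec_seqs i j"
  then obtain \<tau> where \<sigma>: "\<sigma> = j # \<tau>" and last: "last (j # \<tau>) = i" and dec: "sorted_wrt (>) (j # \<tau>)"
    by (cases \<sigma>) (auto simp: dec_seqs_def)
  have "\<tau> \<noteq> []"
    using last assms by auto
  then obtain k \<rho> where \<tau>: "\<tau> = k # \<rho>"
    by (cases \<tau>) auto
  have "i \<le> k"
    using last dec by (auto simp: \<tau> less_imp_le split: if_splits)
  moreover have "k < j" "\<tau> \<in> dec_seqs i k"
    using last dec by (auto simp: \<tau> dec_seqs_def)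
  ultimately show "\<sigma> \<in> (\<Union>k\<in>{i..<j}. (#) j ` dec_seqs i k)"
    by (auto simp: \<sigma>)
next
  fix \<sigma> assume "\<sigma> \<in> (\<Union>k\<in>{i..<j}. (#) j ` dec_seqs i k)"
  then obtain k \<tau> where "k < j" and \<tau>: "\<tau> \<in> dec_seqs i k" and \<sigma>: "\<sigma> = j # \<tau>"
    by auto
  then show "\<sigma> \<in> dec_seqs i j"
    by (cases \<tau>) (auto simp: dec_seqs_def)
qed

lemma chain_weight_refl: "chain_weight K i i = 1"
  by (simp add: chain_weight_def dec_seqs_refl seq_weight_def)

text \<open>
  Decreasing sequences starting at \<open>j\<close> are classified by their second term \<open>k\<close>; the step from
  \<open>j\<close> to \<open>k\<close> contributes the common factor \<open>K j k\<close>.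
\<close>

lemma chain_weight_rec:
  assumes "i < j"
  shows "chain_weight K i j = (\<Sum>k=i..<j. K j k * chain_weight K i k)"
proof -
  have "chain_weight K i j = (\<Sum>k=i..<j. \<Sum>\<sigma>\<in>(#) j ` dec_seqs i k. seq_weight K \<sigma>)"
    unfolding chain_weight_def dec_seqs_split_first[OF assms]
    by (rule sum.UNION_disjoint) (auto simp: finite_dec_seqs, auto simp: dec_seqs_def)
  also have "\<dots> = (\<Sum>k=i..<j. K j k * chain_weight K i k)"
    unfolding chain_weight_def sum_distrib_left
    by (rule sum.cong[OF refl], subst sum.reindex)
      (auto simp: dec_seqs_def seq_weight_Cons intro!: sum.cong)
  finally show ?thesis .
qed

lemma chain_weight_nonneg:
  assumes "\<And>k l. i \<le> l \<Longrightarrow> l < k \<Longrightarrow> k \<le> j \<Longrightarrow> 0 \<le> K k l" and "i \<le> j"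
  shows "0 \<le> chain_weight K i j"
  using assms
proof (induction j rule: less_induct)
  case (less j)
  show ?case
  proof (cases "i = j")
    case True
    then show ?thesis
      by (simp add: chain_weight_refl)
  next
    case False
    with less.prems(2) have "i < j"
      by simp
    moreover have "0 \<le> chain_weight K i k" if "i \<le> k" "k < j" for k
      using less.prems(1) that by (intro less.IH) auto
    ultimately show ?thesis
      using less.prems(1) by (auto simp: chain_weight_rec intro!: sum_nonneg mult_nonneg_nonneg)
  qed
qed

section \<open>Recursively computed arguments\<close>

lemma all_args_stable: "j \<le> k \<Longrightarrow> all_args U k x j = all_args U j x j"
  by (induction k) (auto simp: le_Suc_eq)

lemma all_args_in_tuples:
  assumes "\<And>i. 1 \<le> i \<Longrightarrow> i \<le> p \<Longrightarrow> U i \<in> tuples d i \<rightarrow> carrier_vec (d i)"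
    and "x \<in> carrier_vec (d 0)" and "k \<le> p"
  shows "all_args U k x \<in> tuples d (Suc k)"
  using assms(3)
proof (induction k)
  case 0
  then show ?case
    using assms(2) by (auto simp: tuples_def PiE_iff extensional_def)
next
  case (Suc k)
  then have IH: "all_args U k x \<in> tuples d (Suc k)"
    by simp
  moreover have "U (Suc k) (all_args U k x) \<in> carrier_vec (d (Suc k))"
    using assms(1)[of "Suc k"] Suc.prems IH by auto
  ultimately show ?case
    by (auto simp: tuples_def PiE_iff extensional_def less_Suc_eq)
qed

text \<open>
  The joint estimate for \<open>U i\<close> bounds the variation of the \<open>i\<close>-th solution by that of the earlier
  ones, with the coefficients \<open>K i j\<close> of the recursion for \<open>chain_weight\<close>.
\<close>

lemma all_args_lipschitz:
  assumes norm: "\<And>i. i \<le> p \<Longrightarrow> is_norm (d i) (\<nu> i)"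
    and U: "\<And>i. 1 \<le> i \<Longrightarrow> i \<le> p \<Longrightarrow> U i \<in> tuples d i \<rightarrow> carrier_vec (d i)"
    and lip: "\<And>i j. 1 \<le> i \<Longrightarrow> i \<le> p \<Longrightarrow> j < i \<Longrightarrow> lipschitz_in_arg d \<nu> i j (K i j) (\<nu> i) (U i)"
    and x: "x \<in> carrier_vec (d 0)" and y: "y \<in> carrier_vec (d 0)"
    and "i \<le> p"
  shows "\<nu> i (all_args U i x i - all_args U i y i) \<le> chain_weight K 0 i * \<nu> 0 (x - y)"
  using \<open>i \<le> p\<close>
proof (induction i rule: less_induct)
  case (less i)
  show ?case
  proof (cases i)
    case 0
    then show ?thesis
      by (simp add: chain_weight_refl)
  next
    case (Suc k)
    let ?u = "all_args U k x" and ?v = "all_args U k y"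
    have uv: "?u \<in> tuples d i" "?v \<in> tuples d i"
      using all_args_in_tuples[OF U] x y less.prems unfolding Suc by (meson Suc_leD)+
    have IH: "\<nu> j (?u j - ?v j) \<le> chain_weight K 0 j * \<nu> 0 (x - y)" if "j < i" for j
      using less.IH[of j] less.prems that all_args_stable[of j k U] by (simp add: Suc)
    have "\<nu> i (U i ?u - U i ?v) \<le> (\<Sum>j<i. K i j * \<nu> j (?u j - ?v j))"
      using joint_lipschitz_estimate[OF norm U lip uv] less.prems Suc by simp
    also have "\<dots> \<le> (\<Sum>j<i. K i j * (chain_weight K 0 j * \<nu> 0 (x - y)))"
      using IH lip[of i] less.prems Suc
      by (intro sum_mono mult_left_mono) (auto simp: lipschitz_in_arg_def)
    also have "\<dots> = chain_weight K 0 i * \<nu> 0 (x - y)"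
      using Suc by (simp add: chain_weight_rec sum_distrib_right distrib_right mult.assoc atLeast0LessThan)
    finally show ?thesis
      by (simp add: Suc)
  qed
qed

lemma solution_map_in_carrier:
  assumes "A i \<in> tuples d i \<rightarrow> GL (d i)" and "F i \<in> tuples d i \<rightarrow> carrier_vec (d i)"
  shows "solution_map d A F i \<in> tuples d i \<rightarrow> carrier_vec (d i)"
proof
  fix w assume w: "w \<in> tuples d i"
  interpret semiring "ring_mat TYPE(real) (d i) ()"
    by (rule semiring_mat)
  have "GL_inverse (d i) (A i w) \<in> carrier_mat (d i) (d i)"
    using Units_inv_closed[of "A i w"] assms(1) w by (auto simp: ring_mat_simps)
  then show "solution_map d A F i w \<in> carrier_vec (d i)"
    using funcset_mem[OF assms(2) w] by (simp add: solution_map_def)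
qed

section \<open>The contraction theorem\<close>

theorem theorem3p1:
  fixes p :: nat
    and d :: "nat \<Rightarrow> nat"
    and \<nu> :: "nat \<Rightarrow> real vec \<Rightarrow> real"
    and \<phi> :: "(nat \<Rightarrow> real vec) \<Rightarrow> real vec"
    and A :: "nat \<Rightarrow> (nat \<Rightarrow> real vec) \<Rightarrow> real mat"
    and F :: "nat \<Rightarrow> (nat \<Rightarrow> real vec) \<Rightarrow> real vec"
    and L :: "nat \<Rightarrow> real"
    and K :: "nat \<Rightarrow> nat \<Rightarrow> real"
  assumes "p \<ge> 1"
    and "\<And>i. i \<le> p \<Longrightarrow> is_norm (d i) (\<nu> i)"
    and "\<And>i. 1 \<le> i \<Longrightarrow> i \<le> p \<Longrightarrow> A i \<in> tuples d i \<rightarrow> GL (d i)"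
    and "\<And>i. 1 \<le> i \<Longrightarrow> i \<le> p \<Longrightarrow> F i \<in> tuples d i \<rightarrow> carrier_vec (d i)"
    and "\<phi> \<in> tuples d (Suc p) \<rightarrow> carrier_vec (d 0)"
    and "\<And>i. i \<le> p \<Longrightarrow> lipschitz_in_arg d \<nu> (Suc p) i (L i) (\<nu> 0) \<phi>"
    and "\<And>i j. 1 \<le> i \<Longrightarrow> i \<le> p \<Longrightarrow> j < i \<Longrightarrow>
           lipschitz_in_arg d \<nu> i j (K i j) (\<nu> i) (solution_map d A F i)"
    and "L 0 + (\<Sum>j=1..p. L j *
           (\<Sum>\<sigma>\<in>dec_seqs 0 j. \<Prod>m=1..length \<sigma> - 1. K (\<sigma> ! (m - 1)) (\<sigma> ! m))) < 1"
  shows "is_contraction (d 0) (\<nu> 0) (\<lambda>x. \<phi> (all_args (solution_map d A F) p x))"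
proof -
  note norm = assms(2) and \<phi> = assms(5) and lip_\<phi> = assms(6) and lip_U = assms(7)
  let ?U = "solution_map d A F"
  let ?c = "\<Sum>j\<le>p. L j * chain_weight K 0 j"
  have U: "?U i \<in> tuples d i \<rightarrow> carrier_vec (d i)" if "1 \<le> i" "i \<le> p" for i
    using assms(3,4) that by (intro solution_map_in_carrier)
  have args: "all_args ?U p x \<in> tuples d (Suc p)" if "x \<in> carrier_vec (d 0)" for x
    using U that by (rule all_args_in_tuples) auto
  have L_nonneg: "0 \<le> L j" if "j \<le> p" for j
    using lip_\<phi>[OF that] by (simp add: lipschitz_in_arg_def)
  have "0 \<le> chain_weight K 0 j" if "j \<le> p" for j
    using lip_U that by (intro chain_weight_nonneg) (auto simp: lipschitz_in_arg_def)
  then have "0 \<le> ?c"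
    using L_nonneg by (auto intro!: sum_nonneg)
  have "?c = L 0 + (\<Sum>j=1..p. L j * chain_weight K 0 j)"
    by (simp add: atMost_atLeast0 sum.atLeast_Suc_atMost chain_weight_refl)
  also have "\<dots> < 1"
    using assms(8) by (simp add: chain_weight_def seq_weight_def)
  finally have "?c < 1" .
  have "\<nu> 0 (\<phi> (all_args ?U p x) - \<phi> (all_args ?U p y)) \<le> ?c * \<nu> 0 (x - y)"
    if x: "x \<in> carrier_vec (d 0)" and y: "y \<in> carrier_vec (d 0)" for x y
  proof -
    let ?u = "all_args ?U p x" and ?v = "all_args ?U p y"
    have "\<nu> 0 (\<phi> ?u - \<phi> ?v) \<le> (\<Sum>j<Suc p. L j * \<nu> j (?u j - ?v j))"
      using lip_\<phi> by (intro joint_lipschitz_estimate[OF norm \<phi> _ args[OF x] args[OF y]]) auto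
    also have "\<dots> = (\<Sum>j\<le>p. L j * \<nu> j (?u j - ?v j))"
      by (simp only: lessThan_Suc_atMost)
    also have "\<dots> \<le> (\<Sum>j\<le>p. L j * (chain_weight K 0 j * \<nu> 0 (x - y)))"
    proof (intro sum_mono mult_left_mono)
      fix j assume "j \<in> {..p}"
      then show "\<nu> j (?u j - ?v j) \<le> chain_weight K 0 j * \<nu> 0 (x - y)"
        using all_args_lipschitz[OF norm U lip_U x y, of p j] all_args_stable[of j p ?U] by simp
    qed (simp add: L_nonneg)
    also have "\<dots> = ?c * \<nu> 0 (x - y)"
      by (simp add: sum_distrib_right mult.assoc)
    finally show ?thesis .
  qed
  moreover have "(\<lambda>x. \<phi> (all_args ?U p x)) \<in> carrier_vec (d 0) \<rightarrow> carrier_vec (d 0)"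
    using \<phi> args by auto
  ultimately show ?thesis
    unfolding is_contraction_def using \<open>0 \<le> ?c\<close> \<open>?c < 1\<close> by blast
qed

end
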